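(* Let $G$ be a second countable, locally compact, Hausdorff group and $\mathcal H$ a separable Hilbert space. Any measurable weak representation $(U_g)_{g\in G}$ of $G$ on $\mathcal H$ is equal almost everywhere to a continuous group representation: there is a strongly continuous homomorphism $V\colon G\to\mathcal U(\mathcal H)$ into the unitary group with $U_g=V_g$ for almost all $g\in G$ with respect to Haar measure.
   Context: A measurable weak representation of $G$ on $\mathcal H$ is a Haar-measurable map $g\mapsto U_g$ from $G$ to the unitary group $\mathcal U(\mathcal H)$ (with the Borel structure of the strong, equivalently weak, operator topology) such that $U_gU_h=U_{gh}$ holds for almost all $(g,h)\in G\times G$ with respect to the product of Haar measures. *)

theory Defs
  imports "HOL-Analysis.Analysis"
begin

text \<open>Complex Hilbert spaces. The inner product is antilinear in its first argument; the real
  scalar multiplication, the norm and the topology are those of the superclass.\<close>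

class complex_hilbert_space = banach +
  fixes scaleC :: "complex \<Rightarrow> 'a \<Rightarrow> 'a"  (infixr "*\<^sub>C" 75)
    and cinner :: "'a \<Rightarrow> 'a \<Rightarrow> complex"
  assumes scaleC_add_right: "c *\<^sub>C (x + y) = c *\<^sub>C x + c *\<^sub>C y"
    and scaleC_add_left: "(c + d) *\<^sub>C x = c *\<^sub>C x + d *\<^sub>C x"
    and scaleC_scaleC: "c *\<^sub>C (d *\<^sub>C x) = (c * d) *\<^sub>C x"
    and scaleR_eq_scaleC: "r *\<^sub>R x = complex_of_real r *\<^sub>C x"
    and cinner_commute: "cinner x y = cnj (cinner y x)"
    and cinner_add_right: "cinner x (y + z) = cinner x y + cinner x z"
    and cinner_scaleC_right: "cinner x (c *\<^sub>C y) = c * cinner x y"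
    and cinner_self_nonneg: "0 \<le> Re (cinner x x)"
    and cinner_self_eq_zero_iff: "cinner x x = 0 \<longleftrightarrow> x = 0"
    and norm_eq_sqrt_cinner: "norm x = sqrt (Re (cinner x x))"

text \<open>The library type of bounded operators only asks for real linearity, so complex linearity
  is part of the definition.\<close>

definition unitary_group :: "('h::complex_hilbert_space \<Rightarrow>\<^sub>L 'h) set" where
  "unitary_group = {u. (\<forall>c x. blinfun_apply u (c *\<^sub>C x) = c *\<^sub>C blinfun_apply u x) \<and>
     (\<forall>x y. cinner (blinfun_apply u x) (blinfun_apply u y) = cinner x y) \<and>
     surj (blinfun_apply u)}"

definition unitary_topology :: "('h::complex_hilbert_space \<Rightarrow>\<^sub>L 'h) topology" where
  "unitary_topology = subtopology strong_operator_topology unitary_group"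

definition unitary_borel :: "('h::complex_hilbert_space \<Rightarrow>\<^sub>L 'h) measure" where
  "unitary_borel = sigma unitary_group {W. openin unitary_topology W}"

text \<open>Groups are written additively, following the library class \<open>topological_group_add\<close>,
  which does not assume commutativity. A (left) Haar measure is a nonzero Radon measure that is
  invariant under left translations.\<close>

definition haar_measure :: "'g::topological_group_add measure \<Rightarrow> bool" where
  "haar_measure \<mu> \<longleftrightarrow>
     sets \<mu> = sets borel \<and>
     emeasure \<mu> UNIV \<noteq> 0 \<and>
     (\<forall>K. compact K \<longrightarrow> K \<in> sets borel \<longrightarrow> emeasure \<mu> K < \<infinity>) \<and>
     (\<forall>A \<in> sets borel. emeasure \<mu> A = (INF W \<in> {W. open W \<and> A \<subseteq> W}. emeasure \<mu> W)) \<and>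
     (\<forall>W. open W \<longrightarrow>
        emeasure \<mu> W = (SUP K \<in> {K. compact K \<and> K \<in> sets borel \<and> K \<subseteq> W}. emeasure \<mu> K)) \<and>
     (\<forall>g. \<forall>A \<in> sets borel. emeasure \<mu> ((\<lambda>h. g + h) ` A) = emeasure \<mu> A)"

text \<open>Haar measurability refers to the completed measure. In the almost-everywhere condition no
  completion is needed, since \<open>AE\<close> only asks that the exceptional set be contained in a
  measurable null set. The library product measure is the usual one for \<open>\<sigma>\<close>-finite factors;
  Haar measures on second countable locally compact groups are \<open>\<sigma>\<close>-finite.\<close>

definition measurable_weak_representation ::
  "'g::topological_group_add measure \<Rightarrow> ('g \<Rightarrow> 'h::complex_hilbert_space \<Rightarrow>\<^sub>L 'h) \<Rightarrow> bool" where
  "measurable_weak_representation \<mu> U \<longleftrightarrow>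
     U \<in> completion \<mu> \<rightarrow>\<^sub>M unitary_borel \<and>
     (AE (g, h) in \<mu> \<Otimes>\<^sub>M \<mu>. U g o\<^sub>L U h = U (g + h))"

definition continuous_unitary_representation ::
  "('g::topological_group_add \<Rightarrow> 'h::complex_hilbert_space \<Rightarrow>\<^sub>L 'h) \<Rightarrow> bool" where
  "continuous_unitary_representation V \<longleftrightarrow>
     continuous_map euclidean unitary_topology V \<and>
     (\<forall>g h. V (g + h) = V g o\<^sub>L V h)"

end

theory Submission
  imports Defs
begin

text \<open>For almost every \<open>g\<close>, the operator \<open>U (g + h) (U h)\<inverse>\<close> does not depend on \<open>h\<close>, up to null
  sets. By left invariance of the null sets the \<open>g\<close> with this property form a subgroup; being
  conull, it is the whole group, and the essential value \<open>V g\<close> is multiplicative in \<open>g\<close>. For the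
  continuity at a vector \<open>z\<close>, given \<open>e > 0\<close>, separability of the Hilbert space gives some \<open>x\<close> for which
  \<open>A = {g. norm (V g x - z) < e}\<close> has positive measure; then \<open>norm (V g z - z) < 2 * e\<close> for
  all \<open>g\<close> in the difference set of \<open>A\<close>, which is a neighbourhood of the identity by Steinhaus'
  theorem.\<close>

section \<open>Unitary operators\<close>

lemma blinfun_compose_assoc: "(f o\<^sub>L g) o\<^sub>L h = f o\<^sub>L (g o\<^sub>L h)"
  by (rule blinfun_eqI) simp

lemma blinfun_compose_id [simp]: "f o\<^sub>L id_blinfun = f" "id_blinfun o\<^sub>L f = f"
  by (auto intro: blinfun_eqI)

lemma unitary_group_norm:
  assumes "u \<in> unitary_group"
  shows "norm (blinfun_apply u x) = norm x"
  using assms by (simp add: unitary_group_def norm_eq_sqrt_cinner)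

lemma unitary_group_dist:
  assumes "u \<in> unitary_group"
  shows "dist (blinfun_apply u x) (blinfun_apply u y) = dist x y"
  by (simp add: dist_norm unitary_group_norm[OF assms] flip: blinfun.diff_right)

lemma unitary_group_compose:
  assumes "u \<in> unitary_group" "v \<in> unitary_group"
  shows "u o\<^sub>L v \<in> unitary_group"
proof -
  have "surj (blinfun_apply u \<circ> blinfun_apply v)"
    using assms by (intro comp_surj) (auto simp: unitary_group_def)
  moreover have "blinfun_apply (u o\<^sub>L v) = blinfun_apply u \<circ> blinfun_apply v"
    by (simp add: fun_eq_iff)
  ultimately show ?thesis
    using assms by (simp add: unitary_group_def)
qed

text \<open>A surjective isometry is bijective, and applying \<open>u\<close> to both sides reduces
  the identities required of the inverse to known ones for \<open>u\<close>. The norm bound with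
  constant 1 makes the inverse function a bounded operator.\<close>

lemma unitary_group_inverse:
  assumes "u \<in> unitary_group"
  obtains v where "v \<in> unitary_group" "v o\<^sub>L u = id_blinfun" "u o\<^sub>L v = id_blinfun"
proof -
  let ?i = "inv (blinfun_apply u)"
  have "inj (blinfun_apply u)"
    by (rule injI) (metis unitary_group_dist[OF assms] dist_eq_0_iff)
  moreover have "surj (blinfun_apply u)"
    using assms by (simp add: unitary_group_def)
  ultimately have iu: "?i (blinfun_apply u x) = x" and ui: "blinfun_apply u (?i x) = x" for x
    by (simp_all add: surj_f_inv_f)
  have eqI: "x = y" if "blinfun_apply u x = blinfun_apply u y" for x y
    using that iu by metis
  have scC: "blinfun_apply u (c *\<^sub>C x) = c *\<^sub>C blinfun_apply u x" for c x
    using assms by (simp add: unitary_group_def)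
  have cin: "cinner (blinfun_apply u x) (blinfun_apply u y) = cinner x y" for x y
    using assms by (simp add: unitary_group_def)
  have "bounded_linear ?i"
  proof (rule bounded_linear_intro[where K = 1])
    show "?i (x + y) = ?i x + ?i y" for x y
      by (rule eqI) (simp add: blinfun.add_right ui)
    show "?i (r *\<^sub>R x) = r *\<^sub>R ?i x" for r x
      by (rule eqI) (simp add: blinfun.scaleR_right ui)
    show "norm (?i x) \<le> norm x * 1" for x
      using unitary_group_norm[OF assms, of "?i x"] by (simp add: ui)
  qed
  then have app: "blinfun_apply (Blinfun ?i) = ?i"
    by (rule bounded_linear_Blinfun_apply)
  have "?i (c *\<^sub>C x) = c *\<^sub>C ?i x" for c x
    by (rule eqI) (simp add: scC ui)
  moreover have "cinner (?i x) (?i y) = cinner x y" for x y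
    using cin[of "?i x" "?i y"] by (simp add: ui)
  moreover have "surj ?i"
    by (metis iu surjI)
  ultimately have "Blinfun ?i \<in> unitary_group"
    by (simp add: unitary_group_def app)
  moreover have "Blinfun ?i o\<^sub>L u = id_blinfun" "u o\<^sub>L Blinfun ?i = id_blinfun"
    by (auto intro!: blinfun_eqI simp: app iu ui)
  ultimately show ?thesis
    using that by blast
qed

text \<open>Multiply by the inverse of \<open>u\<close>. This cancellation lets a single point
  \<open>h\<close> determine the operator \<open>T\<close> in
  \<open>U (g + h) = T o\<^sub>L U h\<close>.\<close>

lemma unitary_group_right_cancel:
  assumes "u \<in> unitary_group" "s o\<^sub>L u = t o\<^sub>L u"
  shows "s = t"
  by (metis assms unitary_group_inverse blinfun_compose_assoc blinfun_compose_id(1))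

section \<open>Haar measures\<close>

text \<open>Each point has an open neighbourhood inside a compact set, and by Lindelof countably
  many of these neighbourhoods cover the space.\<close>

lemma second_countable_locally_compact_countable_cover:
  assumes "locally_compact_space (euclidean :: 'a::second_countable_topology topology)"
  obtains \<K> :: "'a::second_countable_topology set set" where "countable \<K>" "\<And>K. K \<in> \<K> \<Longrightarrow> compact K" "\<Union>\<K> = UNIV"
proof -
  have "\<exists>W K. open W \<and> compact K \<and> x \<in> W \<and> W \<subseteq> K" for x :: 'a
    using assms unfolding locally_compact_space_def by auto
  then obtain W K where WK: "\<And>x::'a. open (W x) \<and> compact (K x) \<and> x \<in> W x \<and> W x \<subseteq> K x"
    by metis
  obtain \<F> where \<F>: "\<F> \<subseteq> range W" "countable \<F>" "\<Union>\<F> = \<Union>(range W)"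
    using Lindelof[of "range W"] WK by auto
  from \<F>(1,2) obtain X where X: "countable X" "\<F> = W ` X"
    by (meson countable_subset_image)
  show ?thesis
  proof (rule that[of "K ` X"])
    show "countable (K ` X)" using X by simp
    show "\<And>L. L \<in> K ` X \<Longrightarrow> compact L" using WK by auto
    have "(\<Union>x\<in>X. W x) = UNIV"
      using \<F>(3) WK X(2) by auto
    moreover have "(\<Union>x\<in>X. W x) \<subseteq> (\<Union>x\<in>X. K x)"
      using WK by (intro UN_mono) auto
    ultimately show "\<Union>(K ` X) = UNIV"
      by blast
  qed
qed

context
  fixes \<mu> :: "'g::{topological_group_add, t2_space, second_countable_topology} measure"
  assumes lc: "locally_compact_space (euclidean :: 'g topology)"
    and haar: "haar_measure \<mu>"
begin

section \<open>Regularity, translations and null sets of a Haar measure\<close>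

lemma haar_sets [measurable_cong]: "sets \<mu> = sets borel"
  using haar by (simp add: haar_measure_def)

lemma haar_space [simp]: "space \<mu> = UNIV"
  using sets_eq_imp_space_eq[OF haar_sets] by simp

lemma haar_compact_finite: "compact K \<Longrightarrow> emeasure \<mu> K < \<infinity>"
  using haar borel_compact[of K] unfolding haar_measure_def by blast

lemma haar_outer_regular:
  assumes "A \<in> sets borel" "emeasure \<mu> A < c"
  obtains W where "open W" "A \<subseteq> W" "emeasure \<mu> W < c"
proof -
  have "(INF W \<in> {W. open W \<and> A \<subseteq> W}. emeasure \<mu> W) < c"
    using haar assms by (simp add: haar_measure_def)
  then show ?thesis
    using that by (auto simp: INF_less_iff)
qed

lemma haar_translate:
  assumes "A \<in> sets borel"
  shows "(\<lambda>h. g + h) ` A \<in> sets borel" "emeasure \<mu> ((\<lambda>h. g + h) ` A) = emeasure \<mu> A"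
proof -
  have "(\<lambda>h. g + h) ` A = (\<lambda>h. - g + h) -` A \<inter> space borel"
    by (auto simp: image_iff add.assoc[symmetric]) (metis add.assoc add.right_inverse add.left_neutral)
  moreover have "(\<lambda>h. - g + h) \<in> borel \<rightarrow>\<^sub>M borel"
    by (intro borel_measurable_continuous_onI continuous_intros)
  ultimately show "(\<lambda>h. g + h) ` A \<in> sets borel"
    using assms by (metis measurable_sets)
  show "emeasure \<mu> ((\<lambda>h. g + h) ` A) = emeasure \<mu> A"
    using haar assms by (simp add: haar_measure_def)
qed

text \<open>The points where \<open>P (g + h)\<close> fails form the left translate by
  \<open>- g\<close> of those where \<open>P\<close> fails, and left translates of null sets are
  null.\<close>

lemma haar_AE_translate:
  assumes "AE h in \<mu>. P h"
  shows "AE h in \<mu>. P (g + h)"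
proof -
  obtain N where N: "{h. \<not> P h} \<subseteq> N" "N \<in> sets \<mu>" "emeasure \<mu> N = 0"
    using assms by (auto elim: AE_E)
  have "{h. \<not> P (g + h)} \<subseteq> (\<lambda>h. - g + h) ` N"
    using N(1) by (auto simp: image_iff intro!: bexI[of _ "g + _"] simp: add.assoc[symmetric])
  moreover have "(\<lambda>h. - g + h) ` N \<in> null_sets \<mu>"
    using N haar_translate[of N "- g"] by (auto simp: haar_sets null_sets_def)
  ultimately show ?thesis
    by (auto intro: AE_I')
qed

text \<open>A Haar measure is nonzero, so the empty set is not conull. This serves to pick a point
  satisfying conull conditions.\<close>

lemma haar_AE_ex:
  assumes "AE h in \<mu>. P h"
  shows "\<exists>h. P h"
proof (rule ccontr)
  assume "\<nexists>h. P h"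
  then have "AE h in \<mu>. False"
    using assms by simp
  then have "emeasure \<mu> UNIV = 0"
    by (simp add: AE_iff_null null_sets_def)
  then show False
    using haar by (simp add: haar_measure_def)
qed

text \<open>Countably many compact sets, each of finite measure, cover the group. This allows
  almost-everywhere statements on the product to be split into iterated ones.\<close>

lemma haar_sigma_finite: "sigma_finite_measure \<mu>"
proof
  obtain \<K> :: "'g set set" where \<K>: "countable \<K>" "\<And>K. K \<in> \<K> \<Longrightarrow> compact K" "\<Union>\<K> = UNIV"
    using second_countable_locally_compact_countable_cover[OF lc] by metis
  have "K \<in> sets \<mu>" "emeasure \<mu> K \<noteq> \<infinity>" if "K \<in> \<K>" for K
    using haar_compact_finite[of K] \<K>(2)[OF that] by (auto simp: haar_sets borel_compact)
  with \<K>(1,3) show "\<exists>A. countable A \<and> A \<subseteq> sets \<mu> \<and> \<Union>A = space \<mu> \<and> (\<forall>a\<in>A. emeasure \<mu> a \<noteq> \<infinity>)"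
    by (intro exI[of _ \<K>]) auto
qed

text \<open>The definition grants inner regularity for open sets only. For Borel \<open>B\<close>,
  some compact \<open>K\<close> meets \<open>B\<close> in positive measure; outer regularity of
  \<open>K - B\<close> then gives an open set whose removal from \<open>K\<close> leaves a compact
  subset of \<open>B\<close>.\<close>

lemma haar_inner_compact:
  assumes B: "B \<in> sets borel" "emeasure \<mu> B \<noteq> 0"
  obtains K where "compact K" "K \<subseteq> B" "emeasure \<mu> K \<noteq> 0"
proof -
  obtain \<K> :: "'g set set" where \<K>: "countable \<K>" "\<And>K. K \<in> \<K> \<Longrightarrow> compact K" "\<Union>\<K> = UNIV"
    using second_countable_locally_compact_countable_cover[OF lc] by metis
  have meas: "B \<inter> K \<in> sets \<mu>" if "K \<in> \<K>" for K
    using that B \<K>(2) by (auto simp: haar_sets intro: borel_compact)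
  have "\<exists>K\<in>\<K>. emeasure \<mu> (B \<inter> K) \<noteq> 0"
  proof (rule ccontr)
    assume "\<not> ?thesis"
    then have "(\<Union>K\<in>\<K>. B \<inter> K) \<in> null_sets \<mu>"
      using meas by (intro null_sets_UN' \<K>(1)) auto
    moreover have "(\<Union>K\<in>\<K>. B \<inter> K) = B"
      using \<K>(3) by auto
    ultimately show False
      using B(2) by (simp add: null_sets_def)
  qed
  then obtain K where K: "K \<in> \<K>" "emeasure \<mu> (B \<inter> K) \<noteq> 0"
    by blast
  have cK: "compact K" and bK: "K \<in> sets borel"
    using K \<K>(2) borel_compact by auto
  have fin: "emeasure \<mu> (K - B) < \<infinity>"
    using haar_compact_finite[OF cK] emeasure_mono[of "K - B" K \<mu>] bK
    by (auto simp: haar_sets intro: le_less_trans)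
  have "emeasure \<mu> K = emeasure \<mu> (K - B) + emeasure \<mu> (B \<inter> K)"
    using B bK by (subst plus_emeasure) (auto simp: haar_sets intro: arg_cong[where f = "emeasure \<mu>"])
  \<comment> \<open>The inequality is strict because \<open>K - B\<close> has finite measure. It
    leaves room for an open \<open>W\<close> around \<open>K - B\<close> that is still smaller than
    \<open>K\<close> in measure, so \<open>K - W\<close> is not null.\<close>
  then have "emeasure \<mu> (K - B) < emeasure \<mu> K"
    using K(2) fin ennreal_add_left_cancel_less[of "emeasure \<mu> (K - B)" 0]
    by (simp add: zero_less_iff_neq_zero less_top)
  then obtain W where W: "open W" "K - B \<subseteq> W" "emeasure \<mu> W < emeasure \<mu> K"
    using haar_outer_regular[of "K - B"] B bK by auto
  show ?thesis
  proof (rule that[of "K - W"])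
    show "compact (K - W)"
      using cK W(1) by (rule compact_diff)
    show "K - W \<subseteq> B"
      using W by auto
    show "emeasure \<mu> (K - W) \<noteq> 0"
    proof
      assume "emeasure \<mu> (K - W) = 0"
      moreover have "emeasure \<mu> K \<le> emeasure \<mu> ((K - W) \<union> W)"
        using bK W(1) by (intro emeasure_mono) (auto simp: haar_sets)
      moreover have "\<dots> \<le> emeasure \<mu> (K - W) + emeasure \<mu> W"
        using bK W(1) by (intro emeasure_subadditive) (auto simp: haar_sets)
      ultimately show False
        using W(3) by auto
    qed
  qed
qed

text \<open>Take a compact \<open>K\<close> in \<open>B\<close> of positive measure and an open
  \<open>W\<close> around it with less than twice its measure. For \<open>g\<close> near
  \<open>0\<close> the translate of \<open>K\<close> by \<open>g\<close> stays in \<open>W\<close>,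
  so it cannot be disjoint from \<open>K\<close>.\<close>

theorem haar_Steinhaus:
  assumes "B \<in> sets borel" "emeasure \<mu> B \<noteq> 0"
  obtains N where "open N" "0 \<in> N" "\<And>g. g \<in> N \<Longrightarrow> \<exists>b\<in>B. g + b \<in> B"
proof -
  obtain K where K: "compact K" "K \<subseteq> B" "emeasure \<mu> K \<noteq> 0"
    using haar_inner_compact[OF assms] by blast
  have bK: "K \<in> sets borel"
    using K(1) by (rule borel_compact)
  have "emeasure \<mu> K < emeasure \<mu> K + emeasure \<mu> K"
    using K(3) haar_compact_finite[OF K(1)] ennreal_add_left_cancel_less[of "emeasure \<mu> K" 0]
    by (simp add: zero_less_iff_neq_zero less_top)
  then obtain W where W: "open W" "K \<subseteq> W" "emeasure \<mu> W < emeasure \<mu> K + emeasure \<mu> K"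
    using haar_outer_regular[OF bK] by blast
  \<comment> \<open>Compactness of \<open>K\<close> gives, through the tube lemma, one neighbourhood
    \<open>N\<close> of \<open>0\<close> with \<open>g + b \<in> W\<close> for all
    \<open>g \<in> N\<close> and all \<open>b \<in> K\<close> at once.\<close>
  have "open ((\<lambda>p. fst p + snd p :: 'g) -` W)"
    using W(1) by (intro open_vimage continuous_intros)
  moreover have "{0} \<times> K \<subseteq> (\<lambda>p. fst p + snd p) -` W"
    using W(2) by auto
  ultimately have "\<exists>N. 0 \<in> N \<and> open N \<and> N \<times> K \<subseteq> (\<lambda>p. fst p + snd p) -` W"
    by (rule Elementary_Topology.tube_lemma[OF K(1)])
  then obtain N where N: "0 \<in> N" "open N" "N \<times> K \<subseteq> (\<lambda>p. fst p + snd p) -` W"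
    by blast
  show ?thesis
  proof (rule that[OF N(2,1)], rule ccontr)
    fix g
    assume g: "g \<in> N" "\<not> (\<exists>b\<in>B. g + b \<in> B)"
    have "emeasure \<mu> K + emeasure \<mu> K = emeasure \<mu> K + emeasure \<mu> ((\<lambda>h. g + h) ` K)"
      using haar_translate(2)[OF bK] by simp
    also have "\<dots> = emeasure \<mu> (K \<union> (\<lambda>h. g + h) ` K)"
      using g(2) K(2) bK haar_translate(1)[OF bK]
      by (intro plus_emeasure) (auto simp: haar_sets)
    also have "\<dots> \<le> emeasure \<mu> W"
      using N(3) g(1) W(1,2) by (intro emeasure_mono) (auto simp: haar_sets)
    finally show False
      using W(3) by simp
  qed
qed

section \<open>Weak representations\<close>

lemma weak_representation_homomorphism:
  assumes U: "\<And>g. U g \<in> (unitary_group :: ('h::complex_hilbert_space \<Rightarrow>\<^sub>L 'h) set)"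
    and ae: "AE g in \<mu>. AE h in \<mu>. U (g + h) = U g o\<^sub>L U h"
  obtains V where "\<And>g. V g \<in> unitary_group" "\<And>g h. V (g + h) = V g o\<^sub>L V h"
    "AE g in \<mu>. U g = V g"
proof -
  \<comment> \<open>\<open>Q g T\<close> says that \<open>T\<close> is the essential value of
    \<open>U (g + h)\<close> times the inverse of \<open>U h\<close>, as a function of
    \<open>h\<close>.\<close>
  define Q where "Q g T \<longleftrightarrow> T \<in> unitary_group \<and> (AE h in \<mu>. U (g + h) = T o\<^sub>L U h)" for g T
  have Q_unique: "S = T" if "Q g S" "Q g T" for g S T
  proof -
    have "AE h in \<mu>. S o\<^sub>L U h = T o\<^sub>L U h"
      using that by (auto simp: Q_def)
    then obtain h where "S o\<^sub>L U h = T o\<^sub>L U h"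
      using haar_AE_ex by blast
    then show ?thesis
      by (rule unitary_group_right_cancel[OF U])
  qed
  have Q_add: "Q (g + k) (S o\<^sub>L T)" if "Q g S" "Q k T" for g k S T
  proof -
    \<comment> \<open>The condition on \<open>g\<close> is read at \<open>k + h\<close> in place of
      \<open>h\<close>, by left invariance of null sets.\<close>
    have "AE h in \<mu>. U (g + (k + h)) = S o\<^sub>L U (k + h)"
      using that(1) by (intro haar_AE_translate) (simp add: Q_def)
    moreover have "AE h in \<mu>. U (k + h) = T o\<^sub>L U h"
      using that(2) by (simp add: Q_def)
    ultimately have "AE h in \<mu>. U (g + k + h) = (S o\<^sub>L T) o\<^sub>L U h"
      by eventually_elim (simp add: add.assoc blinfun_compose_assoc)
    then show ?thesis
      using that by (simp add: Q_def unitary_group_compose)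
  qed
  have Q_minus: "\<exists>S. Q (- g) S" if "Q g T" for g T
  proof -
    have "T \<in> unitary_group"
      using that by (simp add: Q_def)
    then obtain S where S: "S \<in> unitary_group" "S o\<^sub>L T = id_blinfun"
      by (rule unitary_group_inverse)
    \<comment> \<open>Reading the condition at \<open>- g + h\<close> turns its left side into
      \<open>U h\<close>; the inverse \<open>S\<close> then moves \<open>T\<close> across.\<close>
    have "AE h in \<mu>. U (g + (- g + h)) = T o\<^sub>L U (- g + h)"
      using that by (intro haar_AE_translate) (simp add: Q_def)
    then have "AE h in \<mu>. U (- g + h) = S o\<^sub>L U h"
    proof eventually_elim
      case (elim h)
      then have "S o\<^sub>L U h = (S o\<^sub>L T) o\<^sub>L U (- g + h)"
        by (simp add: add.assoc[symmetric] blinfun_compose_assoc)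
      then show ?case
        using S(2) by simp
    qed
    then show ?thesis
      using S(1) by (auto simp: Q_def)
  qed
  have Q_AE: "AE g in \<mu>. Q g (U g)"
    using ae U by (simp add: Q_def)
  have "\<exists>T. Q g T" for g
  proof -
    \<comment> \<open>A conull subgroup is the whole group: some \<open>x\<close> has both
      \<open>x\<close> and \<open>g + x\<close> in it, and
      \<open>g = (g + x) + (- x)\<close>.\<close>
    have "AE x in \<mu>. Q x (U x) \<and> Q (g + x) (U (g + x))"
      using Q_AE haar_AE_translate[OF Q_AE, of g] by eventually_elim simp
    then obtain x where x: "Q x (U x)" "Q (g + x) (U (g + x))"
      using haar_AE_ex by blast
    obtain S where "Q (- x) S"
      using Q_minus[OF x(1)] by blast
    from Q_add[OF x(2) this] show ?thesis
      by (auto simp: add.assoc)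
  qed
  then obtain V where V: "\<And>g. Q g (V g)"
    by metis
  show ?thesis
  proof (rule that)
    show "V g \<in> unitary_group" for g
      using V by (simp add: Q_def)
    show "V (g + h) = V g o\<^sub>L V h" for g h
      using Q_unique V Q_add by blast
    show "AE g in \<mu>. U g = V g"
      using Q_AE by eventually_elim (use Q_unique V in blast)
  qed
qed

section \<open>Automatic continuity of measurable homomorphisms\<close>

lemma measurable_homomorphism_continuous:
  fixes V :: "'g \<Rightarrow> 'h::complex_hilbert_space \<Rightarrow>\<^sub>L 'h"
  assumes sep: "separable_space (euclidean :: 'h topology)"
    and V: "\<And>g. V g \<in> unitary_group" "\<And>g h. V (g + h) = V g o\<^sub>L V h"
    and U: "\<And>x z e. {g. dist (blinfun_apply (U g) x) z < e} \<in> sets (completion \<mu>)"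
    and ae: "AE g in \<mu>. U g = V g"
  shows "continuous_map euclidean unitary_topology V"
proof -
  obtain C :: "'h set" where C: "countable C" "closure C = UNIV"
    using sep by (auto simp: separable_space_def)
  have V0: "blinfun_apply (V 0) x = x" for x
  proof -
    have "V 0 o\<^sub>L V 0 = id_blinfun o\<^sub>L V 0"
      using V(2)[of 0 0] by simp
    then have "V 0 = id_blinfun"
      using V(1) unitary_group_right_cancel by blast
    then show ?thesis
      by simp
  qed
  have near_0: "\<exists>N. open N \<and> 0 \<in> N \<and> (\<forall>g\<in>N. dist (blinfun_apply (V g) z) z < e)"
    if "e > 0" for z e
  proof -
    \<comment> \<open>The set is defined by \<open>U\<close>, for which measurability is assumed.
      The radius is \<open>e / 2\<close> because two such estimates are added in the end.\<close>
    define A where "A x = {g. dist (blinfun_apply (U g) x) z < e / 2}" for x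
    obtain M where "{g. U g \<noteq> V g} \<subseteq> M" and M: "M \<in> null_sets \<mu>"
      using ae by (auto elim!: AE_E simp: null_sets_def)
    then have UV: "U g = V g" if "g \<notin> M" for g
      using that by blast
    have cover: "UNIV = M \<union> (\<Union>x\<in>C. A x)"
    proof -
      have "\<exists>x\<in>C. g \<in> A x" if "g \<notin> M" for g
      proof -
        \<comment> \<open>A point of \<open>C\<close> near \<open>V (- g) z\<close> is carried near
          \<open>z\<close> by the isometry \<open>V g\<close>.\<close>
        have "blinfun_apply (V (- g)) z \<in> closure C"
          using C by simp
        then obtain x where x: "x \<in> C" "dist x (blinfun_apply (V (- g)) z) < e / 2"
          using \<open>e > 0\<close> by (metis closure_approachable half_gt_zero)
        have "blinfun_apply (V g) (blinfun_apply (V (- g)) z) = z"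
          using V(2)[of g "- g"] V0[of z] by (simp flip: blinfun_apply_blinfun_compose)
        then have "dist (blinfun_apply (V g) x) z < e / 2"
          using x(2) unitary_group_dist[OF V(1)[of g], of x "blinfun_apply (V (- g)) z"] by simp
        then show ?thesis
          using UV[OF that] x(1) by (auto simp: A_def)
      qed
      then show ?thesis by auto
    qed
    have "\<exists>x\<in>C. A x \<notin> null_sets (completion \<mu>)"
    proof (rule ccontr)
      assume "\<not> ?thesis"
      then have "(\<Union>x\<in>C. A x) \<in> null_sets (completion \<mu>)"
        by (intro null_sets_UN' C(1)) auto
      then have "UNIV \<in> null_sets (completion \<mu>)"
        using null_sets.Un[OF null_sets_completionI[OF M]] cover by metis
      then have "AE g in completion \<mu>. False"
        by (intro AE_I'[of UNIV]) auto
      then show False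
        using haar_AE_ex[of "\<lambda>_. False"] by (simp add: AE_completion_iff)
    qed
    then obtain x where x: "A x \<notin> null_sets (completion \<mu>)"
      by blast
    have Ax: "A x \<in> sets (completion \<mu>)"
      unfolding A_def by (rule U)
    \<comment> \<open>\<open>A x\<close> is measurable only for the completion, while Steinhaus'
      theorem asks for a Borel set. The main part is Borel with the same measure, and removing the
      null set \<open>M\<close> ensures \<open>U = V\<close> on \<open>B\<close>.\<close>
    define B where "B = main_part \<mu> (A x) - M"
    have pos: "emeasure \<mu> (main_part \<mu> (A x)) \<noteq> 0"
      using x Ax by (auto simp: null_sets_def emeasure_completion)
    have "emeasure \<mu> B = emeasure \<mu> (main_part \<mu> (A x))"
      unfolding B_def using Ax M by (intro emeasure_Diff_null_set) auto
    moreover have "B \<in> sets borel"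
      unfolding B_def using main_part_sets[OF Ax] M haar_sets by (metis null_setsD2 sets.Diff)
    ultimately obtain N where N: "open N" "0 \<in> N" "\<And>g. g \<in> N \<Longrightarrow> \<exists>b\<in>B. g + b \<in> B"
      using haar_Steinhaus pos by metis
    have B: "dist (blinfun_apply (V b) x) z < e / 2" if "b \<in> B" for b
    proof -
      have "main_part \<mu> (A x) \<subseteq> A x"
        using main_part_null_part_Un[OF Ax] by blast
      then have "b \<in> A x" "b \<notin> M"
        using that by (auto simp: B_def)
      then show ?thesis
        by (simp add: A_def UV)
    qed
    have "dist (blinfun_apply (V g) z) z < e" if g: "g \<in> N" for g
    proof -
      obtain b where b: "b \<in> B" "g + b \<in> B"
        using N(3)[OF g] by blast
      \<comment> \<open>\<open>V (g + b) x\<close> lies within \<open>e / 2\<close> of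
        \<open>V g z\<close>, as the image under \<open>V g\<close> of the estimate at
        \<open>b\<close>, and within \<open>e / 2\<close> of \<open>z\<close>, by the estimate at
        \<open>g + b\<close>.\<close>
      have "dist (blinfun_apply (V g) z) (blinfun_apply (V (g + b)) x) < e / 2"
        using B[OF b(1)] by (simp add: V(2) unitary_group_dist[OF V(1)] dist_commute)
      then show ?thesis
        using B[OF b(2)] by (metis dist_commute dist_triangle_half_r)
    qed
    with N(1,2) show ?thesis
      by blast
  qed
  have "continuous_on UNIV (\<lambda>g. blinfun_apply (V g) z)" for z
    unfolding continuous_on_def
  proof (intro ballI tendstoI)
    fix k :: 'g and e :: real
    assume "e > 0"
    then obtain N where N: "open N" "0 \<in> N" "\<And>g. g \<in> N \<Longrightarrow> dist (blinfun_apply (V g) z) z < e"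
      using near_0 by metis
    \<comment> \<open>Continuity at \<open>k\<close> reduces to the estimate near \<open>0\<close>:
      since \<open>V k\<close> is an isometry, the distance from \<open>V g z\<close> to
      \<open>V k z\<close> equals that from \<open>V (- k + g) z\<close> to
      \<open>z\<close>.\<close>
    have "((\<lambda>g. - k + g) \<longlongrightarrow> - k + k) (at k)"
      by (intro tendsto_intros)
    then have "eventually (\<lambda>g. - k + g \<in> N) (at k)"
      using N(1,2) by (intro topological_tendstoD) auto
    then show "eventually (\<lambda>g. dist (blinfun_apply (V g) z) (blinfun_apply (V k) z) < e) (at k)"
    proof eventually_elim
      case (elim g)
      have "V g = V k o\<^sub>L V (- k + g)"
        using V(2)[of k "- k + g"] by (simp add: add.assoc[symmetric])
      then show ?case
        using N(3)[OF elim] by (simp add: unitary_group_dist[OF V(1)])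
    qed
  qed
  then show ?thesis
    unfolding unitary_topology_def continuous_map_in_subtopology
      continuous_on_strong_operator_topo_iff_coordinatewise
    using V(1) by auto
qed

end

text \<open>Evaluation at \<open>x\<close> is strongly continuous, so the unitaries sending
  \<open>x\<close> into an open ball around \<open>z\<close> form a relatively open set, which is a
  generator of the sigma-algebra of \<open>unitary_borel\<close>.\<close>

lemma unitary_borel_evaluation:
  fixes U :: "'g \<Rightarrow> 'h::complex_hilbert_space \<Rightarrow>\<^sub>L 'h"
  assumes "U \<in> M \<rightarrow>\<^sub>M unitary_borel"
  shows "{g \<in> space M. dist (blinfun_apply (U g) x) z < e} \<in> sets M"
proof -
  let ?W = "{u \<in> unitary_group. dist (blinfun_apply u x) z < e}"
  have "openin strong_operator_topology
      {u \<in> topspace strong_operator_topology. blinfun_apply u x \<in> ball z e}"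
    by (rule openin_continuous_map_preimage[OF strong_operator_topology_continuous_evaluation]) simp
  then have "openin unitary_topology ?W"
    unfolding unitary_topology_def openin_subtopology
    by (rule_tac exI[of _ "{u. blinfun_apply u x \<in> ball z e}"])
      (auto simp: strong_operator_topology_topspace dist_commute)
  moreover have sub: "{W. openin unitary_topology W} \<subseteq> Pow (unitary_group :: ('h \<Rightarrow>\<^sub>L 'h) set)"
    unfolding unitary_topology_def using openin_subset by fastforce
  ultimately have "?W \<in> sets unitary_borel"
    unfolding unitary_borel_def by (simp add: sets_measure_of[OF sub])
  then have "U -` ?W \<inter> space M \<in> sets M"
    by (rule measurable_sets[OF assms])
  moreover have "U -` ?W \<inter> space M = {g \<in> space M. dist (blinfun_apply (U g) x) z < e}"
    using measurable_space[OF assms] sub by (auto simp: unitary_borel_def space_measure_of)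
  ultimately show ?thesis
    by simp
qed

theorem corollary3p26:
  fixes \<mu> :: "'g::{topological_group_add, t2_space, second_countable_topology} measure"
    and U :: "'g \<Rightarrow> 'h::complex_hilbert_space \<Rightarrow>\<^sub>L 'h"
  assumes "locally_compact_space (euclidean :: 'g topology)"
    and "haar_measure \<mu>"
    and "separable_space (euclidean :: 'h topology)"
    and "measurable_weak_representation \<mu> U"
  shows "\<exists>V. continuous_unitary_representation V \<and> (AE g in \<mu>. U g = V g)"
proof -
  note lh = assms(1,2)
  interpret sigma_finite_measure \<mu>
    using haar_sigma_finite[OF lh] .
  interpret pair_sigma_finite \<mu> \<mu> ..
  have meas: "U \<in> completion \<mu> \<rightarrow>\<^sub>M unitary_borel"
    and "AE (g, h) in \<mu> \<Otimes>\<^sub>M \<mu>. U g o\<^sub>L U h = U (g + h)"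
    using assms(4) by (auto simp: measurable_weak_representation_def)
  from AE_pair[OF this(2)] have ae: "AE g in \<mu>. AE h in \<mu>. U (g + h) = U g o\<^sub>L U h"
    by (simp add: eq_commute)
  \<comment> \<open>Unitarity holds at every \<open>g\<close>, not just almost every one, since the
    space of \<open>unitary_borel\<close> is \<open>unitary_group\<close>.\<close>
  have "U g \<in> unitary_group" for g
    using measurable_space[OF meas, of g] haar_space[OF lh]
    by (simp add: unitary_borel_def space_measure_of_conv)
  then obtain V where V: "\<And>g. V g \<in> unitary_group" "\<And>g h. V (g + h) = V g o\<^sub>L V h"
    "AE g in \<mu>. U g = V g"
    using weak_representation_homomorphism[OF lh _ ae] by metis
  have "{g. dist (blinfun_apply (U g) x) z < e} \<in> sets (completion \<mu>)" for x z e
    using unitary_borel_evaluation[OF meas, of x z e] haar_space[OF lh] by simp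
  then have "continuous_map euclidean unitary_topology V"
    using measurable_homomorphism_continuous[OF lh assms(3) V(1,2) _ V(3)] by blast
  then show ?thesis
    using V(2,3) by (auto simp: continuous_unitary_representation_def)
qed

end
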